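(* Let $\sigma$ be any pattern (a fixed permutation), and let $$h_{\sigma} = \lim_{n \rightarrow \infty} \sum_{i=1}^{n-1-|\sigma|} \frac{|Av_i(\sigma)|}{(i-1)!}=\sum_{i=1}^{\infty}\frac{|Av_i(\sigma)|}{(i-1)!},$$ which is finite. If $\pi$ is a uniformly random permutation of size $n$, then $$\mathrm{Prob}(\pi \notin Av_n(\sigma;2)) \sim \frac{2 h_{\sigma}}{n^2}\qquad (n\to\infty).$$
   Context: $\mathcal{S}_n$ is the set of permutations $\pi=\pi_1\pi_2\dots\pi_n$ of $\{1,\dots,n\}$ in one-line notation. Write $\sigma\prec\pi$ if $\pi$ contains the pattern $\sigma$ in the classical sense (some subsequence of $\pi$, not necessarily consecutive, is order-isomorphic to $\sigma$), and $\sigma\nprec\pi$ otherwise. $Av_n(\sigma)=\{\pi\in\mathcal{S}_n:\sigma\nprec\pi\}$, and $|\sigma|$ is the size of $\sigma$. For an entry $k$ of $\pi$, let $s_\pi(k)$ be the biggest sub-string (block of consecutive positions) of $\pi$ that contains the entry $k$ and all of whose entries are greater than or equal to $k$. The sub-permutation of $\pi$ generated by $k$, denoted $g_\pi(k)$, is the permutation obtained by rescaling $s_\pi(k)$ (replacing its entries by $1,2,\dots,|s_\pi(k)|$ in an order-preserving way). For a pattern $\sigma$ and an integer $k\ge 1$, $Av(\sigma;k)$ is the set of permutations $\pi$ for which: $\pi$ avoids $\sigma$ if and only if $g_\pi(k)$ avoids $\sigma$. Equivalently, if $\sigma\prec\pi$ then $\sigma\prec g_\pi(k)$. $Av_n(\sigma;k)=Av(\sigma;k)\cap\mathcal{S}_n$.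 Thus $\pi\notin Av_n(\sigma;k)$ means $\sigma\prec\pi$ and $\sigma\nprec g_\pi(k)$. $f(n)\sim g(n)$ denotes asymptotic equivalence, $f(n)-g(n)=o(g(n))$ as $n\to\infty$. *)

theory Defs
  imports
    "HOL-Probability.Probability"
    "HOL-Library.Sublist"
    "HOL-Library.Landau_Symbols"
    "HOL-Combinatorics.Multiset_Permutations"
begin

definition perms :: "nat \<Rightarrow> nat list set" where
  "perms n = permutations_of_set {1..n}"

definition order_isomorphic :: "nat list \<Rightarrow> nat list \<Rightarrow> bool" where
  "order_isomorphic xs ys \<longleftrightarrow> length xs = length ys \<and>
     (\<forall>i<length xs. \<forall>j<length xs. xs ! i < xs ! j \<longleftrightarrow> ys ! i < ys ! j)"

definition contains_pattern :: "nat list \<Rightarrow> nat list \<Rightarrow> bool" (infix "\<prec>\<^sub>p" 50) where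
  "\<sigma> \<prec>\<^sub>p \<pi> \<longleftrightarrow> (\<exists>ys. subseq ys \<pi> \<and> order_isomorphic ys \<sigma>)"

definition Av :: "nat \<Rightarrow> nat list \<Rightarrow> nat list set" where
  "Av n \<sigma> = {\<pi> \<in> perms n. \<not> \<sigma> \<prec>\<^sub>p \<pi>}"

(* The maximiser exists and is unique when k is an entry of the permutation \<pi>;
   otherwise gen_substring \<pi> k is unspecified. *)
definition gen_substring :: "nat list \<Rightarrow> nat \<Rightarrow> nat list" where
  "gen_substring \<pi> k =
     arg_max length (\<lambda>ys. sublist ys \<pi> \<and> k \<in> set ys \<and> (\<forall>y\<in>set ys. k \<le> y))"

definition rescale :: "nat list \<Rightarrow> nat list" where
  "rescale xs = map (\<lambda>x. card {y \<in> set xs. y \<le> x}) xs"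

definition gen_subperm :: "nat list \<Rightarrow> nat \<Rightarrow> nat list" where
  "gen_subperm \<pi> k = rescale (gen_substring \<pi> k)"

definition Av_gen :: "nat \<Rightarrow> nat list \<Rightarrow> nat \<Rightarrow> nat list set" where
  "Av_gen n \<sigma> k = {\<pi> \<in> perms n. \<not> \<sigma> \<prec>\<^sub>p \<pi> \<longleftrightarrow> \<not> \<sigma> \<prec>\<^sub>p gen_subperm \<pi> k}"

definition h_term :: "nat list \<Rightarrow> nat \<Rightarrow> real" where
  "h_term \<sigma> i = real (card (Av i \<sigma>)) / fact (i - 1)"

(* The truncated subtraction in the upper bound only matters for n \<le> |\<sigma>|, where the sum is empty. *)
definition h_partial :: "nat list \<Rightarrow> nat \<Rightarrow> real" where
  "h_partial \<sigma> n = (\<Sum>i=1..n - 1 - length \<sigma>. h_term \<sigma> i)"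

definition h_const :: "nat list \<Rightarrow> real" where
  "h_const \<sigma> = lim (h_partial \<sigma>)"

end

theory Submission
  imports Defs "HOL-Real_Asymp.Real_Asymp"
begin

text \<open>
  Write a permutation as \<open>A 1 B\<close>: the entry 2 generates whichever of \<open>A\<close> and \<open>B\<close> contains it.
  Choosing the side and the other entries of this part, exactly
  \<open>2 (n - 2)! |Av_i(\<sigma>)| / (i - 1)!\<close> permutations of size \<open>n\<close> have a generated sub-permutation of
  size \<open>i\<close> that avoids \<open>\<sigma>\<close>. Among these, the ones to discard are those avoiding \<open>\<sigma>\<close>
  altogether, whose proportion is negligible: cutting a permutation into consecutive blocks shows
  that the probability of avoiding \<open>\<sigma>\<close> is submultiplicative, hence exponentially small (no
  Stanley-Wilf bound is needed). The same estimate makes the series converge.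
\<close>

subsection \<open>Pattern containment\<close>

lemma contains_pattern_subseq:
  "\<sigma> \<prec>\<^sub>p xs \<Longrightarrow> subseq xs ys \<Longrightarrow> \<sigma> \<prec>\<^sub>p ys"
  unfolding contains_pattern_def using subseq_order.order_trans by blast

lemma contains_pattern_refl: "\<sigma> \<prec>\<^sub>p \<sigma>"
  unfolding contains_pattern_def order_isomorphic_def by blast

lemma subseq_map_rightE:
  assumes "subseq xs (map f ys)"
  obtains zs where "subseq zs ys" "xs = map f zs"
  using assms by (auto simp: subseq_conv_nths nths_map)

lemma order_isomorphic_map:
  assumes "strict_mono_on S f" "set xs \<subseteq> S"
  shows "order_isomorphic (map f xs) ys \<longleftrightarrow> order_isomorphic xs ys"
proof -
  have "f (xs ! i) < f (xs ! j) \<longleftrightarrow> xs ! i < xs ! j" if "i < length xs" "j < length xs" for i j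
    by (rule strict_mono_on_less[OF assms(1)]) (use that assms(2) in auto)
  then show ?thesis
    by (auto simp: order_isomorphic_def)
qed

text \<open>Containment depends only on the relative order of the entries. This serves both to undo
  \<open>rescale\<close> and to move avoiders between ground sets.\<close>

lemma contains_pattern_map:
  assumes "strict_mono_on S f" "set xs \<subseteq> S"
  shows "\<sigma> \<prec>\<^sub>p map f xs \<longleftrightarrow> \<sigma> \<prec>\<^sub>p xs"
proof
  assume "\<sigma> \<prec>\<^sub>p map f xs"
  then obtain zs where zs: "subseq zs xs" "order_isomorphic (map f zs) \<sigma>"
    by (auto simp: contains_pattern_def elim: subseq_map_rightE)
  then have "set zs \<subseteq> S"
    using assms(2) set_nths_subset by (fastforce simp: subseq_conv_nths)
  with zs show "\<sigma> \<prec>\<^sub>p xs"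
    using order_isomorphic_map[OF assms(1)] by (auto simp: contains_pattern_def)
next
  assume "\<sigma> \<prec>\<^sub>p xs"
  then obtain zs where zs: "subseq zs xs" "order_isomorphic zs \<sigma>"
    by (auto simp: contains_pattern_def)
  then have "set zs \<subseteq> S"
    using assms(2) set_nths_subset by (fastforce simp: subseq_conv_nths)
  with zs show "\<sigma> \<prec>\<^sub>p map f xs"
    using order_isomorphic_map[OF assms(1)] subseq_map unfolding contains_pattern_def by blast
qed

section \<open>Ranks within a finite set\<close>

lemma strict_mono_on_rank:
  fixes S :: "nat set"
  assumes "finite S"
  shows "strict_mono_on S (\<lambda>x. card {y \<in> S. y \<le> x})"
proof (rule strict_mono_onI)
  fix r s assume "r \<in> S" "s \<in> S" "r < s"
  then have "s \<in> {y \<in> S. y \<le> s}" "s \<notin> {y \<in> S. y \<le> r}" "{y \<in> S. y \<le> r} \<subseteq> {y \<in> S. y \<le> s}"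
    by auto
  then have "{y \<in> S. y \<le> r} \<subset> {y \<in> S. y \<le> s}" by blast
  then show "card {y \<in> S. y \<le> r} < card {y \<in> S. y \<le> s}"
    using assms by (intro psubset_card_mono) auto
qed

text \<open>Ranks lie between 1 and \<open>card S\<close> and are pairwise distinct, so counting
  forces equality.\<close>

lemma rank_image:
  fixes S :: "nat set"
  assumes "finite S"
  shows "(\<lambda>x. card {y \<in> S. y \<le> x}) ` S = {1..card S}"
proof (rule card_subset_eq)
  show "(\<lambda>x. card {y \<in> S. y \<le> x}) ` S \<subseteq> {1..card S}"
  proof
    fix k assume "k \<in> (\<lambda>x. card {y \<in> S. y \<le> x}) ` S"
    then obtain x where x: "x \<in> S" "k = card {y \<in> S. y \<le> x}" by blast
    then have "card {y \<in> S. y \<le> x} > 0" "card {y \<in> S. y \<le> x} \<le> card S"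
      using assms by (auto simp: card_gt_0_iff intro: card_mono)
    with x show "k \<in> {1..card S}" by simp
  qed
  show "card ((\<lambda>x. card {y \<in> S. y \<le> x}) ` S) = card {1..card S}"
    using strict_mono_on_imp_inj_on[OF strict_mono_on_rank[OF assms]] by (simp add: card_image)
qed simp

lemma contains_pattern_rescale: "\<sigma> \<prec>\<^sub>p rescale xs \<longleftrightarrow> \<sigma> \<prec>\<^sub>p xs"
  unfolding rescale_def by (rule contains_pattern_map[OF strict_mono_on_rank]) auto

subsection \<open>Avoiders on an arbitrary ground set\<close>

text \<open>The blocks of a cut permutation and the part generated by 2 have arbitrary sets of
  entries; staying on that ground set spares rescaling during the counting.\<close>

definition avoiders :: "nat list \<Rightarrow> nat set \<Rightarrow> nat list set" where
  "avoiders \<sigma> S = {xs \<in> permutations_of_set S. \<not> \<sigma> \<prec>\<^sub>p xs}"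

lemma Av_eq_avoiders: "Av n \<sigma> = avoiders \<sigma> {1..n}"
  by (simp add: Av_def avoiders_def perms_def)

lemma finite_avoiders [simp]: "finite (avoiders \<sigma> S)"
  by (simp add: avoiders_def)

text \<open>Ranks preserve order, so replacing each entry by its rank in \<open>S\<close> is a
  bijection onto the avoiders on \<open>{1..card S}\<close>.\<close>

lemma card_avoiders:
  assumes "finite S"
  shows "card (avoiders \<sigma> S) = card (Av (card S) \<sigma>)"
proof -
  define f where "f = (\<lambda>x. card {y \<in> S. y \<le> x})"
  have mono: "strict_mono_on S f"
    unfolding f_def by (rule strict_mono_on_rank[OF assms])
  then have inj: "inj_on f S" by (rule strict_mono_on_imp_inj_on)
  have img: "f ` S = {1..card S}"
    unfolding f_def by (rule rank_image[OF assms])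
  have "Av (card S) \<sigma> = {ys \<in> map f ` permutations_of_set S. \<not> \<sigma> \<prec>\<^sub>p ys}"
    using permutations_of_set_image_inj[OF inj] by (simp add: Av_def perms_def img)
  also have "\<dots> = map f ` avoiders \<sigma> S"
    using contains_pattern_map[OF mono, of _ \<sigma>]
    by (auto simp: avoiders_def permutations_of_setD(1))
  finally have "Av (card S) \<sigma> = map f ` avoiders \<sigma> S" .
  moreover have "inj_on (map f) (avoiders \<sigma> S)"
    by (rule inj_onI, rule map_inj_on[where f = f])
       (auto simp: avoiders_def permutations_of_setD(1) inj)
  ultimately show ?thesis by (simp add: card_image)
qed

section \<open>Exponential decay of the avoidance probability\<close>

definition avoid_prob :: "nat list \<Rightarrow> nat \<Rightarrow> real" where
  "avoid_prob \<sigma> n = real (card (Av n \<sigma>)) / fact n"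

lemma card_perms: "card (perms n) = fact n"
  by (simp add: perms_def)

lemma Av_subset_perms: "Av n \<sigma> \<subseteq> perms n"
  by (auto simp: Av_def)

lemma finite_perms: "finite (perms n)"
  by (simp add: perms_def)

lemma avoid_prob_nonneg: "avoid_prob \<sigma> n \<ge> 0"
  by (simp add: avoid_prob_def)

lemma avoid_prob_le_1: "avoid_prob \<sigma> n \<le> 1"
proof -
  have "card (Av n \<sigma>) \<le> fact n"
    using card_mono[OF finite_perms Av_subset_perms] by (simp add: card_perms)
  then have "real (card (Av n \<sigma>)) \<le> real (fact n)"
    by (rule of_nat_mono)
  then show ?thesis by (simp add: avoid_prob_def)
qed

text \<open>\<sigma> contains itself, so at least one permutation of its size is not an avoider. The
  exponential decay grows out of this strict inequality.\<close>

lemma avoid_prob_length_less_1: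
  assumes "\<sigma> \<in> perms (length \<sigma>)"
  shows "avoid_prob \<sigma> (length \<sigma>) < 1"
proof -
  have "Av (length \<sigma>) \<sigma> \<subset> perms (length \<sigma>)"
    using assms contains_pattern_refl by (auto simp: Av_def)
  then have "card (Av (length \<sigma>) \<sigma>) < fact (length \<sigma>)"
    using psubset_card_mono[OF finite_perms] by (metis card_perms)
  then have "real (card (Av (length \<sigma>) \<sigma>)) < real (fact (length \<sigma>))"
    by (simp only: of_nat_less_iff)
  then show ?thesis by (simp add: avoid_prob_def)
qed

text \<open>A prefix and the complementary suffix of an avoider both avoid, on complementary ground sets.\<close>

lemma card_Av_add_le:
  "card (Av (i + j) \<sigma>) \<le> ((i + j) choose i) * (card (Av i \<sigma>) * card (Av j \<sigma>))"
proof -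
  let ?S = "{1..i + j}"
  let ?W = "{U. U \<subseteq> ?S \<and> card U = i}"
  let ?D = "SIGMA U : ?W. avoiders \<sigma> U \<times> avoiders \<sigma> (?S - U)"
  have finW: "finite ?W" by (rule finite_subset[of _ "Pow ?S"]) auto
  then have finD: "finite ?D" by auto
  \<comment> \<open>Cut after \<open>i\<close> entries; \<open>U\<close> is the set of values before
    the cut. Only an inclusion holds in general, since a copy of \<sigma> may straddle the
    cut.\<close>
  have "avoiders \<sigma> ?S \<subseteq> (\<lambda>(U, xs, ys). xs @ ys) ` ?D"
  proof
    fix zs assume zs: "zs \<in> avoiders \<sigma> ?S"
    let ?xs = "take i zs" and ?ys = "drop i zs"
    have set: "set zs = ?S" and dist: "distinct zs" and av: "\<not> \<sigma> \<prec>\<^sub>p zs"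
      using zs by (auto simp: avoiders_def permutations_of_setD)
    have len: "length zs = i + j"
      using distinct_card[OF dist] set by simp
    have card: "card (set ?xs) = i"
      using distinct_card[of ?xs] dist len by simp
    have "set ?xs \<union> set ?ys = ?S" using set by (metis append_take_drop_id set_append)
    moreover have "set ?xs \<inter> set ?ys = {}"
      using dist by (metis append_take_drop_id distinct_append)
    ultimately have "set ?ys = ?S - set ?xs" "set ?xs \<subseteq> ?S" by auto
    moreover have "\<not> \<sigma> \<prec>\<^sub>p ?xs" "\<not> \<sigma> \<prec>\<^sub>p ?ys"
      using av contains_pattern_subseq
      by (blast intro: sublist_take sublist_drop sublist_imp_subseq)+
    ultimately have "(set ?xs, ?xs, ?ys) \<in> ?D"
      using card dist by (auto simp: avoiders_def simp del: set_take_subset)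
    then show "zs \<in> (\<lambda>(U, xs, ys). xs @ ys) ` ?D"
      by (rule rev_image_eqI) simp
  qed
  then have "card (avoiders \<sigma> ?S) \<le> card ?D"
    using finD by (meson card_image_le card_mono finite_imageI le_trans)
  also have "card ?D = (\<Sum>U\<in>?W. card (avoiders \<sigma> U) * card (avoiders \<sigma> (?S - U)))"
    using finW by (subst card_SigmaI) (auto simp: card_cartesian_product)
  also have "\<dots> = (\<Sum>U\<in>?W. card (Av i \<sigma>) * card (Av j \<sigma>))"
  proof (rule sum.cong[OF refl])
    fix U assume "U \<in> ?W"
    then have "finite U" "card U = i" "card (?S - U) = j"
      by (auto simp: card_Diff_subset finite_subset[of U ?S])
    then show "card (avoiders \<sigma> U) * card (avoiders \<sigma> (?S - U)) = card (Av i \<sigma>) * card (Av j \<sigma>)"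
      using card_avoiders[of U] card_avoiders[of "?S - U"] by simp
  qed
  also have "\<dots> = ((i + j) choose i) * (card (Av i \<sigma>) * card (Av j \<sigma>))"
    using n_subsets[of ?S i] by simp
  finally show ?thesis by (simp add: Av_eq_avoiders)
qed

text \<open>Dividing by \<open>fact (i + j)\<close> turns the binomial coefficient into the
  normalising factorials of the two parts.\<close>

lemma avoid_prob_add_le: "avoid_prob \<sigma> (i + j) \<le> avoid_prob \<sigma> i * avoid_prob \<sigma> j"
proof -
  have "real (card (Av (i + j) \<sigma>))
      \<le> real (((i + j) choose i) * (card (Av i \<sigma>) * card (Av j \<sigma>)))"
    using card_Av_add_le of_nat_mono by blast
  also have "\<dots> = fact (i + j) * (avoid_prob \<sigma> i * avoid_prob \<sigma> j)"
    by (simp add: avoid_prob_def binomial_fact)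
  finally show ?thesis
    by (simp add: avoid_prob_def[of \<sigma> "i + j"] field_simps)
qed

text \<open>By submultiplicativity, each further block of \<open>m\<close> entries costs a factor of
  at most \<open>c\<close>, which is below 1; \<open>d\<close> spreads this factor evenly over the
  entries.\<close>

lemma avoid_prob_exponential_decay:
  assumes "\<sigma> \<in> perms (length \<sigma>)"
  obtains K d :: real where "0 < d" "d < 1" "\<And>n. avoid_prob \<sigma> n \<le> K * d ^ n"
proof -
  \<comment> \<open>The successor keeps \<open>m\<close> positive even for empty \<sigma>, as the
    root and the descent from \<open>n\<close> to \<open>n - m\<close> require.\<close>
  define m where "m = Suc (length \<sigma>)"
  \<comment> \<open>The maximum with 1/2 keeps \<open>c\<close> positive even if every permutation
    of size \<open>m\<close> contains \<sigma>.\<close>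
  define c where "c = max (avoid_prob \<sigma> m) (1 / 2)"
  define d where "d = root m c"
  have "avoid_prob \<sigma> m \<le> avoid_prob \<sigma> (length \<sigma>) * avoid_prob \<sigma> 1"
    using avoid_prob_add_le[of \<sigma> "length \<sigma>" 1] by (simp add: m_def)
  also have "\<dots> \<le> avoid_prob \<sigma> (length \<sigma>) * 1"
    by (intro mult_left_mono avoid_prob_le_1 avoid_prob_nonneg)
  also have "\<dots> < 1"
    using avoid_prob_length_less_1[OF assms] by simp
  finally have c: "0 < c" "c < 1" by (auto simp: c_def)
  then have d: "0 < d" "d < 1" "d ^ m = c"
    using real_root_pow_pos[of m c] by (auto simp: d_def m_def simp del: power_Suc)
  \<comment> \<open>The constant \<open>1 / c\<close> makes the bound at least 1 for
    \<open>n < m\<close>, because \<open>d ^ n\<close> is then at least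
    \<open>d ^ m = c\<close>.\<close>
  have "avoid_prob \<sigma> n \<le> 1 / c * d ^ n" for n
  proof (induction n rule: less_induct)
    case (less n)
    show ?case
    proof (cases "n < m")
      case True
      then have "c \<le> d ^ n"
        using d power_decreasing[of n m d] by simp
      then have "1 \<le> 1 / c * d ^ n" using c by (simp add: field_simps)
      with avoid_prob_le_1 show ?thesis by (rule order_trans)
    next
      case False
      have "avoid_prob \<sigma> n \<le> avoid_prob \<sigma> m * avoid_prob \<sigma> (n - m)"
        using avoid_prob_add_le[of \<sigma> m "n - m"] False by simp
      also have "\<dots> \<le> d ^ m * (1 / c * d ^ (n - m))"
        using False less[of "n - m"] d(3) avoid_prob_nonneg c
        by (intro mult_mono) (auto simp: c_def m_def)
      also have "\<dots> = 1 / c * d ^ n"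
        using False by (simp flip: power_add)
      finally show ?thesis .
    qed
  qed
  then show ?thesis using d that by blast
qed

section \<open>Convergence of the series and negligibility of the avoiders\<close>

lemma h_term_Suc: "h_term \<sigma> (Suc k) = real (Suc k) * avoid_prob \<sigma> (Suc k)"
  by (simp add: h_term_def avoid_prob_def)

lemma h_term_nonneg: "h_term \<sigma> i \<ge> 0"
  by (simp add: h_term_def)

text \<open>The term of index \<open>i\<close> is \<open>i\<close> times an avoidance probability,
  so a multiple of the differentiated geometric series dominates.\<close>

lemma summable_h_term:
  assumes "\<sigma> \<in> perms (length \<sigma>)"
  shows "summable (\<lambda>i. h_term \<sigma> (Suc i))"
proof -
  obtain K d :: real where d: "0 < d" "d < 1" "\<And>n. avoid_prob \<sigma> n \<le> K * d ^ n"
    using avoid_prob_exponential_decay[OF assms] by blast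
  have "summable (\<lambda>n. of_nat (Suc n) * d ^ n)"
    using geometric_deriv_sums[of d] d by (auto simp: sums_iff)
  then have "summable (\<lambda>n. K * d * (of_nat (Suc n) * d ^ n))"
    by (rule summable_mult)
  then show ?thesis
  proof (rule summable_comparison_test')
    fix n
    have "h_term \<sigma> (Suc n) \<le> real (Suc n) * (K * d ^ Suc n)"
      unfolding h_term_Suc by (intro mult_left_mono d) auto
    then show "norm (h_term \<sigma> (Suc n)) \<le> K * d * (of_nat (Suc n) * d ^ n)"
      using h_term_nonneg[of \<sigma> "Suc n"] by (simp add: algebra_simps)
  qed
qed

lemma square_avoid_prob_tendsto_0:
  assumes "\<sigma> \<in> perms (length \<sigma>)"
  shows "(\<lambda>n. real n ^ 2 * avoid_prob \<sigma> n) \<longlonglongrightarrow> 0"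
proof -
  obtain K d :: real where d: "0 < d" "d < 1" "\<And>n. avoid_prob \<sigma> n \<le> K * d ^ n"
    using avoid_prob_exponential_decay[OF assms] by blast
  \<comment> \<open>Since \<open>d ^ n\<close> is the square of \<open>sqrt d ^ n\<close>, the limit
    of \<open>n * x ^ n\<close> for \<open>x = sqrt d\<close> suffices.\<close>
  have "(\<lambda>n. of_nat n * sqrt d ^ n) \<longlonglongrightarrow> 0"
    using d by (intro powser_times_n_limit_0) auto
  then have "(\<lambda>n. K * (of_nat n * sqrt d ^ n) ^ 2) \<longlonglongrightarrow> K * 0 ^ 2"
    by (intro tendsto_intros)
  also have "(\<lambda>n. K * (of_nat n * sqrt d ^ n) ^ 2) = (\<lambda>n. real n ^ 2 * (K * d ^ n))"
    using d(1) by (auto simp: power_mult_distrib power2_eq_square fun_eq_iff simp flip: power_mult_distrib)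
  finally have lim: "(\<lambda>n. real n ^ 2 * (K * d ^ n)) \<longlonglongrightarrow> 0" by simp
  show ?thesis
  proof (rule tendsto_sandwich[OF _ _ tendsto_const lim])
    show "\<forall>\<^sub>F n in sequentially. 0 \<le> real n ^ 2 * avoid_prob \<sigma> n"
      by (simp add: avoid_prob_nonneg)
    show "\<forall>\<^sub>F n in sequentially. real n ^ 2 * avoid_prob \<sigma> n \<le> real n ^ 2 * (K * d ^ n)"
      by (intro always_eventually allI mult_left_mono d) simp
  qed
qed

subsection \<open>Counting by the sub-permutation generated by 2\<close>

text \<open>Requiring every competitor to be a sublist of \<open>xs\<close>, rather than just no
  longer, also yields uniqueness: a sublist of full length is \<open>xs\<close> itself.\<close>

lemma gen_substring_eqI:
  assumes "sublist xs \<pi>" "k \<in> set xs" "\<forall>x\<in>set xs. k \<le> x"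
    and "\<And>ys. sublist ys \<pi> \<Longrightarrow> k \<in> set ys \<Longrightarrow> \<forall>y\<in>set ys. k \<le> y \<Longrightarrow> sublist ys xs"
  shows "gen_substring \<pi> k = xs"
proof -
  let ?P = "\<lambda>ys. sublist ys \<pi> \<and> k \<in> set ys \<and> (\<forall>y\<in>set ys. k \<le> y)"
  let ?m = "arg_max length ?P"
  have P: "?P xs" using assms by blast
  have le: "length ys \<le> length xs" if "?P ys" for ys
    using that assms(4) sublist_length_le by blast
  have "?P ?m"
    by (rule arg_max_natI[of ?P xs length "Suc (length xs)", OF P]) (use le in \<open>auto simp: less_Suc_eq_le\<close>)
  moreover have "length ?m = length xs"
    by (rule arg_max_equality[of ?P xs length, OF P le])
  moreover have "ys = xs" if "sublist ys xs" "length ys = length xs" for ys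
    using that by (auto simp: sublist_def)
  ultimately have "?m = xs" using assms(4) by blast
  then show ?thesis by (simp add: gen_substring_def)
qed

text \<open>A block of consecutive positions meeting both sides would have to pass over
  \<open>x\<close>.\<close>

lemma sublist_avoiding_separator:
  assumes "sublist ys (A @ x # B)" "x \<notin> set ys"
  shows "sublist ys A \<or> sublist ys B"
proof -
  from assms(1) consider "sublist ys A" | "sublist ys (x # B)"
    | us vs where "ys = us @ vs" "suffix us A" "prefix vs (x # B)"
    by (auto simp: sublist_append)
  then show ?thesis
  proof cases
    case 2
    then show ?thesis using assms(2) by (auto simp: sublist_Cons_right prefix_Cons)
  next
    \<comment> \<open>A nonempty prefix of \<open>x # B\<close> starts with \<open>x\<close>, so
      \<open>vs\<close> is empty and \<open>ys\<close> is a suffix of \<open>A\<close>.\<close>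
    case 3
    then show ?thesis using assms(2) by (auto simp: prefix_Cons)
  qed simp
qed

text \<open>A competitor has entries at least 2, so it misses the separator 1 and lies inside one
  side; only \<open>A\<close> contains 2.\<close>

lemma gen_substring_left:
  assumes "2 \<in> set A" "2 \<notin> set B" "\<forall>x\<in>set A. 2 \<le> x"
  shows "gen_substring (A @ 1 # B) 2 = A"
proof (rule gen_substring_eqI)
  fix ys assume ys: "sublist ys (A @ 1 # B)" "2 \<in> set ys" "\<forall>y\<in>set ys. (2::nat) \<le> y"
  then have "1 \<notin> set ys" by auto
  then have "sublist ys A \<or> sublist ys B"
    by (rule sublist_avoiding_separator[OF ys(1)])
  moreover have "\<not> sublist ys B"
    using assms(2) ys(2) set_mono_sublist[of ys B] by auto
  ultimately show "sublist ys A" by simp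
next
  show "sublist A (A @ 1 # B)" by (rule sublist_append_rightI)
  show "2 \<in> set A" by (rule assms(1))
  show "\<forall>x\<in>set A. 2 \<le> x" by (rule assms(3))
qed

lemma gen_substring_right:
  assumes "2 \<in> set B" "2 \<notin> set A" "\<forall>x\<in>set B. 2 \<le> x"
  shows "gen_substring (A @ 1 # B) 2 = B"
proof (rule gen_substring_eqI)
  fix ys assume ys: "sublist ys (A @ 1 # B)" "2 \<in> set ys" "\<forall>y\<in>set ys. (2::nat) \<le> y"
  then have "1 \<notin> set ys" by auto
  then have "sublist ys A \<or> sublist ys B"
    by (rule sublist_avoiding_separator[OF ys(1)])
  moreover have "\<not> sublist ys A"
    using assms(2) ys(2) set_mono_sublist[of ys A] by auto
  ultimately show "sublist ys B" by simp
next
  show "sublist B (A @ 1 # B)"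
    using sublist_append_leftI[of B "A @ [1]"] by simp
  show "2 \<in> set B" by (rule assms(1))
  show "\<forall>x\<in>set B. 2 \<le> x" by (rule assms(3))
qed

section \<open>Enumeration by the set of entries of the generated part\<close>

lemma sum_subsets_by_card:
  fixes f :: "nat \<Rightarrow> nat"
  assumes "finite S"
  shows "(\<Sum>U\<in>Pow S. f (card U)) = (\<Sum>k\<le>card S. (card S choose k) * f k)"
proof -
  have "(\<Sum>U\<in>Pow S. f (card U)) = (\<Sum>k\<le>card S. \<Sum>U\<in>{U \<in> Pow S. card U = k}. f (card U))"
    using assms by (intro sum.group[symmetric]) (auto intro: card_mono)
  also have "\<dots> = (\<Sum>k\<le>card S. (card S choose k) * f k)"
    using n_subsets[OF assms] by (intro sum.cong) (auto simp: Pow_def)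
  finally show ?thesis .
qed

text \<open>Triples \<open>(U, A, B)\<close> stand for the words \<open>A 1 B\<close> and \<open>B 1 A\<close>, where \<open>U\<close> is the set of
  entries of the part \<open>A\<close> generated by 2.\<close>

definition gen_avoiding_triples :: "nat list \<Rightarrow> nat \<Rightarrow> (nat set \<times> nat list \<times> nat list) set" where
  "gen_avoiding_triples \<sigma> n =
     (SIGMA U : {U. U \<subseteq> {2..n} \<and> 2 \<in> U}. avoiders \<sigma> U \<times> permutations_of_set ({2..n} - U))"

text \<open>If the part has \<open>k\<close> entries besides 2, there are
  \<open>n - 2 choose k\<close> choices of them, \<open>card (Av (k + 1) \<sigma>)\<close>
  arrangements of the part and \<open>fact (n - 2 - k)\<close> of the rest. The product is
  \<open>fact (n - 2) * h_term \<sigma> (k + 1)\<close>.\<close>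

lemma card_gen_avoiding_triples:
  assumes "n \<ge> 2"
  shows "real (card (gen_avoiding_triples \<sigma> n)) = fact (n - 2) * (\<Sum>i<n - 1. h_term \<sigma> (Suc i))"
proof -
  let ?W = "{U. U \<subseteq> {2..n} \<and> 2 \<in> U}"
  have finW: "finite ?W" by (rule finite_subset[of _ "Pow {2..n}"]) auto
  have "card (gen_avoiding_triples \<sigma> n)
      = (\<Sum>U\<in>?W. card (avoiders \<sigma> U) * card (permutations_of_set ({2..n} - U)))"
    unfolding gen_avoiding_triples_def
    using finW by (subst card_SigmaI) (auto simp: card_cartesian_product)
  also have "\<dots> = (\<Sum>U\<in>Pow {3..n}. card (Av (card U + 1) \<sigma>) * fact (n - 2 - card U))"
  \<comment> \<open>Removing the compulsory entry 2 leaves an arbitrary subset of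
    \<open>{3..n}\<close>, whence the shift of the size by one.\<close>
  proof (rule sum.reindex_bij_witness[of _ "insert 2" "\<lambda>U. U - {2}"])
    fix U assume U: "U \<in> ?W"
    then have fin: "finite U" using finite_subset by blast
    have "card (U - {2}) + 1 = card U"
      using U fin card_Suc_Diff1[of U 2] by simp
    moreover have "card ({2..n} - U) = n - 1 - card U"
      using U fin by (subst card_Diff_subset) auto
    ultimately show "card (Av (card (U - {2}) + 1) \<sigma>) * fact (n - 2 - card (U - {2}))
        = card (avoiders \<sigma> U) * card (permutations_of_set ({2..n} - U))"
      using card_avoiders[OF fin, of \<sigma>] by (auto simp flip: \<open>card (U - {2}) + 1 = card U\<close>)
    show "insert 2 (U - {2}) = U" using U by auto
    show "U - {2} \<in> Pow {3..n}" using U by fastforce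
  next
    fix U assume "U \<in> Pow {3..n}"
    then have U: "U \<subseteq> {3..n}" by simp
    then show "insert 2 U - {2} = U" by auto
    show "insert 2 U \<in> ?W" using U assms by auto
  qed
  also have "\<dots> = (\<Sum>k\<le>n - 2. (n - 2 choose k) * (card (Av (k + 1) \<sigma>) * fact (n - 2 - k)))"
    using sum_subsets_by_card[of "{3..n}" "\<lambda>k. card (Av (k + 1) \<sigma>) * fact (n - 2 - k)"]
    by (simp add: numeral_eq_Suc)
  finally have "real (card (gen_avoiding_triples \<sigma> n))
      = (\<Sum>k\<le>n - 2. real (n - 2 choose k) * (real (card (Av (k + 1) \<sigma>)) * fact (n - 2 - k)))"
    by simp
  also have "\<dots> = (\<Sum>k\<le>n - 2. fact (n - 2) * h_term \<sigma> (Suc k))"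
    by (intro sum.cong) (auto simp: h_term_def binomial_fact)
  also have "{..n - 2} = {..<n - 1}" using assms by auto
  finally show ?thesis by (simp add: sum_distrib_left)
qed

lemma gen_avoiding_triplesD:
  assumes "(U, A, B) \<in> gen_avoiding_triples \<sigma> n"
  shows "set A = U" "set B = {2..n} - U" "distinct A" "distinct B" "2 \<in> U" "U \<subseteq> {2..n}"
    "\<not> \<sigma> \<prec>\<^sub>p A"
  using assms by (auto simp: gen_avoiding_triples_def avoiders_def permutations_of_setD)

lemma gen_avoiding_triplesI:
  assumes "distinct A" "distinct B" "set A \<inter> set B = {}" "set A \<union> set B = {2..n}"
    "2 \<in> set A" "\<not> \<sigma> \<prec>\<^sub>p A"
  shows "(set A, A, B) \<in> gen_avoiding_triples \<sigma> n"
proof -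
  have "set B = {2..n} - set A" "set A \<subseteq> {2..n}" using assms(3,4) by auto
  then show ?thesis
    using assms by (auto simp: gen_avoiding_triples_def avoiders_def)
qed

text \<open>Cut at the entry 1. All other entries are at least 2, so the side holding 2 is the whole
  generated substring; avoidance constrains this side and leaves the other free.\<close>

lemma gen_avoiding_perms_eq:
  assumes "n \<ge> 2"
  shows "{\<pi> \<in> perms n. \<not> \<sigma> \<prec>\<^sub>p gen_subperm \<pi> 2}
    = (\<lambda>(U, A, B). A @ 1 # B) ` gen_avoiding_triples \<sigma> n
      \<union> (\<lambda>(U, A, B). B @ 1 # A) ` gen_avoiding_triples \<sigma> n" (is "?G = ?L \<union> ?R")
proof (intro subset_antisym subsetI)
  fix \<pi> assume "\<pi> \<in> ?G"
  then have set: "set \<pi> = {1..n}" and dist: "distinct \<pi>" and av: "\<not> \<sigma> \<prec>\<^sub>p gen_substring \<pi> 2"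
    by (auto simp: perms_def permutations_of_setD gen_subperm_def contains_pattern_rescale)
  have "1 \<in> set \<pi>" using set assms by simp
  then obtain A B where \<pi>: "\<pi> = A @ 1 # B" by (auto simp: in_set_conv_decomp)
  have AB: "distinct A" "distinct B" "set A \<inter> set B = {}" "1 \<notin> set A" "1 \<notin> set B"
    using dist \<pi> by auto
  have "set A \<union> set B = {1..n} - {1}" using set AB unfolding \<pi> by auto
  also have "\<dots> = {2..n}" by auto
  finally have un: "set A \<union> set B = {2..n}" .
  then have ge: "\<forall>x\<in>set A. 2 \<le> x" "\<forall>x\<in>set B. 2 \<le> x" by auto
  from un assms have "2 \<in> set A \<or> 2 \<in> set B" by auto
  then show "\<pi> \<in> ?L \<union> ?R"
  proof
    assume 2: "2 \<in> set A"
    then have "gen_substring \<pi> 2 = A"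
      unfolding \<pi> using AB(3) ge by (intro gen_substring_left) auto
    then have "(set A, A, B) \<in> gen_avoiding_triples \<sigma> n"
      using AB un 2 av by (intro gen_avoiding_triplesI) auto
    then have "\<pi> \<in> ?L" by (rule rev_image_eqI) (simp add: \<pi>)
    then show ?thesis ..
  next
    assume 2: "2 \<in> set B"
    then have "gen_substring \<pi> 2 = B"
      unfolding \<pi> using AB(3) ge by (intro gen_substring_right) auto
    then have "(set B, B, A) \<in> gen_avoiding_triples \<sigma> n"
      using AB un 2 av by (intro gen_avoiding_triplesI) auto
    then have "\<pi> \<in> ?R" by (rule rev_image_eqI) (simp add: \<pi>)
    then show ?thesis ..
  qed
next
  fix \<pi> assume "\<pi> \<in> ?L \<union> ?R"
  then obtain U A B where UAB: "(U, A, B) \<in> gen_avoiding_triples \<sigma> n"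
    and \<pi>: "\<pi> = A @ 1 # B \<or> \<pi> = B @ 1 # A" by auto
  note D = gen_avoiding_triplesD[OF UAB]
  have AB: "set A \<union> set B = {2..n}" "set A \<inter> set B = {}" "2 \<in> set A" "2 \<notin> set B"
    using D(1,2,5,6) by auto
  have ge: "\<forall>x\<in>set A \<union> set B. 2 \<le> x" unfolding AB(1) by simp
  have "1 \<notin> set A \<union> set B" unfolding AB(1) by simp
  then have one: "1 \<notin> set A" "1 \<notin> set B" by simp_all
  have "distinct \<pi>" using \<pi> D(3,4) AB(2) one by (elim disjE) auto
  moreover have "set \<pi> = insert 1 (set A \<union> set B)" using \<pi> by (elim disjE) auto
  then have "set \<pi> = {1..n}" using assms unfolding AB(1) by (simp add: atLeastAtMost_insertL numeral_2_eq_2)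
  moreover have "gen_substring \<pi> 2 = A"
    using \<pi> gen_substring_left[OF AB(3,4)] gen_substring_right[OF AB(3,4)] ge by blast
  ultimately show "\<pi> \<in> ?G"
    using D(7) by (auto simp: perms_def gen_subperm_def contains_pattern_rescale)
qed

text \<open>The factor 2 counts the side of 1 on which 2 lies. Neither part contains 1, so the word
  determines its cut and both encodings are injective.\<close>

lemma card_gen_avoiding_perms:
  assumes "n \<ge> 2"
  shows "real (card {\<pi> \<in> perms n. \<not> \<sigma> \<prec>\<^sub>p gen_subperm \<pi> 2})
    = 2 * fact (n - 2) * (\<Sum>i<n - 1. h_term \<sigma> (Suc i))"
proof -
  let ?D = "gen_avoiding_triples \<sigma> n"
  let ?l = "\<lambda>(U, A, B). A @ (1::nat) # B" and ?r = "\<lambda>(U, A, B). B @ (1::nat) # A"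
  have fin: "finite ?D"
    unfolding gen_avoiding_triples_def
    by (intro finite_SigmaI finite_subset[of "{U. U \<subseteq> {2..n} \<and> 2 \<in> U}" "Pow {2..n}"]) auto
  have one: "1 \<notin> set A" "1 \<notin> set B" if "(U, A, B) \<in> ?D" for U A B
    using gen_avoiding_triplesD[OF that] by auto
  have injl: "inj_on ?l ?D"
  proof (rule inj_onI, clarsimp simp del: One_nat_def)
    fix U A B U' A' B'
    assume *: "(U, A, B) \<in> ?D" "(U', A', B') \<in> ?D" "A @ 1 # B = A' @ 1 # B'"
    then have "A = A' \<and> B = B'"
      using one by (metis append_Cons_eq_iff)
    then show "U = U' \<and> A = A' \<and> B = B'"
      using gen_avoiding_triplesD(1)[OF *(1)] gen_avoiding_triplesD(1)[OF *(2)] by auto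
  qed
  have injr: "inj_on ?r ?D"
  proof (rule inj_onI, clarsimp simp del: One_nat_def)
    fix U A B U' A' B'
    assume *: "(U, A, B) \<in> ?D" "(U', A', B') \<in> ?D" "B @ 1 # A = B' @ 1 # A'"
    then have "A = A' \<and> B = B'"
      using one by (metis append_Cons_eq_iff)
    then show "U = U' \<and> A = A' \<and> B = B'"
      using gen_avoiding_triplesD(1)[OF *(1)] gen_avoiding_triplesD(1)[OF *(2)] by auto
  qed
  \<comment> \<open>Equal words would have the same cut, but 2 lies in \<open>A\<close> and not in
    \<open>B'\<close>.\<close>
  have "A @ 1 # B \<noteq> B' @ 1 # A'" if "(U, A, B) \<in> ?D" "(U', A', B') \<in> ?D" for U A B U' A' B'
  proof
    assume "A @ 1 # B = B' @ 1 # A'"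
    then have "A = B'" using one that by (metis append_Cons_eq_iff)
    then show False
      using gen_avoiding_triplesD[OF that(1)] gen_avoiding_triplesD[OF that(2)] by auto
  qed
  then have "?l ` ?D \<inter> ?r ` ?D = {}" by fast
  then have "card (?l ` ?D \<union> ?r ` ?D) = card ?D + card ?D"
    using fin by (simp add: card_Un_disjoint card_image[OF injl] card_image[OF injr] del: One_nat_def)
  then show ?thesis
    using card_gen_avoiding_triples[OF assms, of \<sigma>]
    unfolding gen_avoiding_perms_eq[OF assms] by simp
qed

text \<open>The generated substring is a block of the permutation, hence a subsequence of it. So the
  avoiders of \<sigma> are among the permutations just counted.\<close>

lemma contains_pattern_gen_subperm:
  assumes "n \<ge> 2" "\<pi> \<in> perms n" "\<sigma> \<prec>\<^sub>p gen_subperm \<pi> 2"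
  shows "\<sigma> \<prec>\<^sub>p \<pi>"
proof -
  let ?P = "\<lambda>ys. sublist ys \<pi> \<and> 2 \<in> set ys \<and> (\<forall>y\<in>set ys. 2 \<le> y)"
  have "2 \<in> set \<pi>" using assms(1,2) by (simp add: perms_def permutations_of_setD)
  \<comment> \<open>The block \<open>[2]\<close> is a first competitor, so the value of
    \<open>arg_max\<close> does satisfy its predicate.\<close>
  then obtain us vs where "\<pi> = us @ [2] @ vs" by (auto simp: in_set_conv_decomp)
  then have "?P [2]" by (simp only: sublist_appendI) simp
  moreover have "\<forall>ys. ?P ys \<longrightarrow> length ys < Suc (length \<pi>)"
    using sublist_length_le by (auto simp: less_Suc_eq_le)
  ultimately have "?P (gen_substring \<pi> 2)"
    unfolding gen_substring_def by (rule arg_max_natI)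
  then show ?thesis
    using assms(3) contains_pattern_subseq by (auto simp: gen_subperm_def contains_pattern_rescale)
qed

text \<open>Failure means that the generated part avoids \<sigma> while the permutation does not.
  This is a difference of nested sets, so the formula is exact.\<close>

lemma prob_not_Av_gen:
  assumes "n \<ge> 2"
  shows "measure_pmf.prob (pmf_of_set (perms n)) {\<pi>. \<pi> \<notin> Av_gen n \<sigma> 2}
    = 2 / (real n * (real n - 1)) * (\<Sum>i<n - 1. h_term \<sigma> (Suc i)) - avoid_prob \<sigma> n"
proof -
  let ?G = "{\<pi> \<in> perms n. \<not> \<sigma> \<prec>\<^sub>p gen_subperm \<pi> 2}"
  have ne: "perms n \<noteq> {}" using card_perms[of n] by force
  have sub: "Av n \<sigma> \<subseteq> ?G"
    using contains_pattern_gen_subperm[OF assms] by (auto simp: Av_def)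
  have "perms n \<inter> {\<pi>. \<pi> \<notin> Av_gen n \<sigma> 2} = ?G - Av n \<sigma>"
    using contains_pattern_gen_subperm[OF assms] by (auto simp: Av_def Av_gen_def)
  moreover have "card (?G - Av n \<sigma>) = card ?G - card (Av n \<sigma>)" "card (Av n \<sigma>) \<le> card ?G"
    using sub finite_perms by (auto intro!: card_Diff_subset card_mono intro: finite_subset[OF Av_subset_perms])
  ultimately have "measure_pmf.prob (pmf_of_set (perms n)) {\<pi>. \<pi> \<notin> Av_gen n \<sigma> 2}
      = (real (card ?G) - real (card (Av n \<sigma>))) / fact n"
    using ne finite_perms by (simp add: measure_pmf_of_set card_perms of_nat_diff)
  also have "\<dots> = 2 * fact (n - 2) / fact n * (\<Sum>i<n - 1. h_term \<sigma> (Suc i)) - avoid_prob \<sigma> n"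
    unfolding card_gen_avoiding_perms[OF assms] by (simp add: avoid_prob_def diff_divide_distrib)
  also have "2 * fact (n - 2) / fact n = 2 / (real n * (real n - 1))"
  proof -
    obtain k where "n = Suc (Suc k)" using assms by (metis add_2_eq_Suc le_Suc_ex)
    then have "fact n = real n * (real n - 1) * fact (n - 2)" by simp
    then show ?thesis by simp
  qed
  finally show ?thesis .
qed

subsection \<open>Asymptotics\<close>

lemma h_partial_eq: "h_partial \<sigma> n = (\<Sum>i<n - 1 - length \<sigma>. h_term \<sigma> (Suc i))"
  unfolding h_partial_def by (rule sum.reindex_bij_witness[of _ Suc "\<lambda>i. i - 1"]) auto

theorem mainTheorem5:
  fixes \<sigma> :: "nat list"
  assumes "\<sigma> \<in> perms (length \<sigma>)"
  shows "convergent (h_partial \<sigma>)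
    \<and> (\<lambda>i. h_term \<sigma> (Suc i)) sums h_const \<sigma>
    \<and> (\<lambda>n. measure_pmf.prob (pmf_of_set (perms n)) {\<pi>. \<pi> \<notin> Av_gen n \<sigma> 2})
        \<sim>[at_top] (\<lambda>n. 2 * h_const \<sigma> / real n ^ 2)"
proof -
  let ?h = "\<lambda>i. h_term \<sigma> (Suc i)"
  let ?P = "\<lambda>n. measure_pmf.prob (pmf_of_set (perms n)) {\<pi>. \<pi> \<notin> Av_gen n \<sigma> 2}"
  \<comment> \<open>The exact count sums up to index \<open>n - 1\<close>, whereas
    \<open>h_partial\<close> stops \<open>length \<sigma>\<close> terms earlier for large
    \<open>n\<close>; \<open>shift\<close> gives both the same limit.\<close>
  define S where "S = (\<lambda>n. \<Sum>i<n - 1. ?h i)"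
  have summable: "summable ?h" by (rule summable_h_term[OF assms])
  have shift: "(\<lambda>n. \<Sum>i<n - c. ?h i) \<longlonglongrightarrow> suminf ?h" for c
    using summable_LIMSEQ[OF summable] filterlim_minus_const_nat_at_top[of c]
    by (rule filterlim_compose)
  have lim: "h_partial \<sigma> \<longlonglongrightarrow> suminf ?h"
    unfolding h_partial_eq[abs_def] using shift[of "1 + length \<sigma>"] by (simp add: diff_diff_left)
  then have conv: "convergent (h_partial \<sigma>)" by (auto simp: convergent_def)
  have h: "h_const \<sigma> = suminf ?h" unfolding h_const_def using lim by (rule limI)
  have sums: "?h sums h_const \<sigma>" using summable h by (simp add: summable_sums)
  have "?P \<sim>[at_top] (\<lambda>n. 2 * h_const \<sigma> / real n ^ 2)"
  \<comment> \<open>If the constant is 0, no quotient can be formed, but then all the nonnegative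
    terms vanish and the probability is 0 for \<open>n \<ge> 2\<close>. This happens for instance
    when \<sigma> has at most one entry.\<close>
  proof (cases "h_const \<sigma> = 0")
    case True
    then have zero: "?h i = 0" for i
      using suminf_eq_zero_iff[OF summable] h_term_nonneg h by auto
    have "?P n = 0" if "n \<ge> 2" for n
    proof -
      have "avoid_prob \<sigma> n = 0"
        using zero[of "n - 1"] that by (simp add: h_term_def avoid_prob_def)
      then show ?thesis using zero by (simp add: prob_not_Av_gen[OF that])
    qed
    then have "eventually (\<lambda>n. ?P n = 2 * h_const \<sigma> / real n ^ 2) at_top"
      unfolding eventually_at_top_linorder by (intro exI[of _ 2]) (simp add: True)
    then show ?thesis by (rule asymp_equiv_refl_ev)
  next
    case False
    have "(\<lambda>n. real n / (real n - 1)) \<longlonglongrightarrow> 1" by real_asymp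
    \<comment> \<open>This is the probability multiplied by \<open>n^2 / 2\<close>; the subtracted
      avoiders vanish in the limit.\<close>
    then have "(\<lambda>n. real n / (real n - 1) * S n - real n ^ 2 * avoid_prob \<sigma> n / 2)
        \<longlonglongrightarrow> 1 * h_const \<sigma> - 0 / 2"
      using shift[of 1] square_avoid_prob_tendsto_0[OF assms]
      unfolding h S_def by (intro tendsto_intros) auto
    then have "(\<lambda>n. (real n / (real n - 1) * S n - real n ^ 2 * avoid_prob \<sigma> n / 2) / h_const \<sigma>)
        \<longlonglongrightarrow> (1 * h_const \<sigma> - 0 / 2) / h_const \<sigma>"
      using False by (intro tendsto_divide tendsto_const)
    moreover have "eventually (\<lambda>n. (real n / (real n - 1) * S n - real n ^ 2 * avoid_prob \<sigma> n / 2)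
        / h_const \<sigma> = ?P n / (2 * h_const \<sigma> / real n ^ 2)) at_top"
      using eventually_ge_at_top[of 2]
    proof eventually_elim
      case (elim n)
      then have "real n > 0" "real n - 1 > 0" by auto
      then show ?case
        using False unfolding prob_not_Av_gen[OF elim] S_def
        by (simp add: field_simps power2_eq_square)
    qed
    ultimately have "(\<lambda>n. ?P n / (2 * h_const \<sigma> / real n ^ 2))
        \<longlonglongrightarrow> (1 * h_const \<sigma> - 0 / 2) / h_const \<sigma>"
      by (rule Lim_transform_eventually)
    then show ?thesis using False by (intro asymp_equivI') simp
  qed
  with conv sums show ?thesis by blast
qed

end
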